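(* For every integer $n$, \begin{align*} \frac{1}{\Theta_6(q)}=(-1)^n q^{-\frac{3n^2+n}{2}}\bigg\{&\sum_{\substack{\alpha,\beta\in\mathbb Z\\ \alpha+2\beta=3n+1}}(-1)^\beta\sum_{k_1=|\alpha|}^\infty \binom{2k_1}{k_1+\alpha}A_{k_1}(q)\sum_{k_2=|\beta|}^\infty \binom{2k_2}{k_2+\beta}C_{k_2}(q)\\ &+\sum_{\substack{\alpha,\beta\in\mathbb Z\\ \alpha+2\beta=3n}}(-1)^\beta\sum_{k_1=|\alpha|}^\infty \binom{2k_1}{k_1+\alpha}A_{k_1}(q)\sum_{k_2=|\beta|}^\infty \binom{2k_2}{k_2+\beta}C_{k_2}(q)\bigg\}. \end{align*}
   Context: Here $(a;q)_\infty:=\prod_{j=0}^\infty(1-aq^j)$ for $|q|<1$. Identities may be read as identities of formal Laurent series in $q$ (equivalently, for $0<|q|<1$). MacMahon's $q$-series are, for integers $k\ge 0$ (with the empty-sum convention $A_0(q)=C_0(q)=1$), $$A_k(q):=\sum_{0<t_1<t_2<\cdots<t_k}\frac{q^{t_1+\cdots+t_k}}{(1-q^{t_1})^2\cdots(1-q^{t_k})^2},\qquad C_k(q):=\sum_{0<t_1<t_2<\cdots<t_k}\frac{q^{2t_1+\cdots+2t_k-k}}{(1-q^{2t_1-1})^2\cdots(1-q^{2t_k-1})^2}.$$ The theta function $\Theta_6$ is $$\Theta_6(q):=(q;q)_\infty^3(q;q^2)_\infty^2=\frac12\sum_{n\in\mathbb Z}\chi_6(n)\,n\,q^{\frac{n^2-1}{24}},$$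 where $\chi_6(n)=1$ if $n\equiv1\pmod 6$, $\chi_6(n)=-1$ if $n\equiv-1\pmod 6$, and $\chi_6(n)=0$ otherwise. *)

theory Defs
  imports "HOL-Analysis.Analysis"
begin

text \<open>
  Everything is read analytically, for a complex number \<open>q\<close> with \<open>0 < norm q < 1\<close>; all infinite
  products and sums below then converge absolutely.
\<close>

definition qpochhammer_inf :: "complex \<Rightarrow> complex \<Rightarrow> complex" where
  "qpochhammer_inf a q = (\<Prod>j. 1 - a * q ^ j)"

text \<open>
  A strictly increasing tuple \<open>0 < t\<^sub>1 < \<dots> < t\<^sub>k\<close> is represented by the set
  \<open>T = {t\<^sub>1, \<dots>, t\<^sub>k}\<close> of its entries, i.e. by a \<open>k\<close>-element set of positive integers.
  For \<open>k = 0\<close> the only such set is empty, which gives the value 1.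
\<close>

definition increasing_tuples :: "nat \<Rightarrow> nat set set" where
  "increasing_tuples k = {T. finite T \<and> card T = k \<and> (\<forall>t\<in>T. 0 < t)}"

definition MacMahon_A :: "nat \<Rightarrow> complex \<Rightarrow> complex" where
  "MacMahon_A k q =
     (\<Sum>\<^sub>\<infinity>T\<in>increasing_tuples k. q ^ (\<Sum>t\<in>T. t) / (\<Prod>t\<in>T. (1 - q ^ t)\<^sup>2))"

text \<open>The subtractions on \<^typ>\<open>nat\<close> below do not truncate, since the elements of \<open>T\<close> are positive.\<close>

definition MacMahon_C :: "nat \<Rightarrow> complex \<Rightarrow> complex" where
  "MacMahon_C k q =
     (\<Sum>\<^sub>\<infinity>T\<in>increasing_tuples k. q ^ ((\<Sum>t\<in>T. 2 * t) - k) / (\<Prod>t\<in>T. (1 - q ^ (2 * t - 1))\<^sup>2))"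

definition Theta6 :: "complex \<Rightarrow> complex" where
  "Theta6 q = qpochhammer_inf q q ^ 3 * qpochhammer_inf q (q\<^sup>2) ^ 2"

end

theory Submission
  imports Defs "HOL-Library.Nat_Bijection"
begin

text \<open>
  The inner sums are the Laurent coefficients in \<open>z\<close> of \<open>\<Prod>t. (1 + z y\<^sub>t) (1 + y\<^sub>t/z) / (1 - y\<^sub>t)\<^sup>2\<close>
  with \<open>y\<^sub>t = q\<^sup>t\<close> for \<open>A\<close> and \<open>y\<^sub>t\<close> running through the odd powers of \<open>q\<close> for \<open>C\<close>. By the Jacobi triple
  product, consecutive \<open>A\<close>-coefficients sum to a theta coefficient over \<open>(q;q)\<^sup>3\<close>, and each
  \<open>C\<close>-coefficient is \<open>q\<close> to the power \<open>\<beta>\<^sup>2\<close> over \<open>(q;q\<^sup>2)\<^sup>2 (q\<^sup>2;q\<^sup>2)\<close>. The two sums over the lines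
  \<open>\<alpha> + 2\<beta> = 3n + 1\<close> and \<open>\<alpha> + 2\<beta> = 3n\<close> thus combine to a single theta series, which after
  completing the square at \<open>\<beta> = n - \<gamma>\<close> is Euler's pentagonal series for \<open>(q\<^sup>2;q\<^sup>2)\<close>.
  To avoid infinite products in \<open>z\<close>, the triple product is used in its finite form, where it is a
  recurrence for coefficients, and the number of factors is sent to infinity coefficientwise.
\<close>

subsection \<open>Finite and infinite q-Pochhammer symbols\<close>

definition qpochhammer :: "complex \<Rightarrow> complex \<Rightarrow> nat \<Rightarrow> complex" where
  "qpochhammer a q n = (\<Prod>j<n. 1 - a * q ^ j)"

lemma qpochhammer_0 [simp]: "qpochhammer a q 0 = 1"
  by (simp add: qpochhammer_def)

lemma qpochhammer_Suc: "qpochhammer a q (Suc n) = qpochhammer a q n * (1 - a * q ^ n)"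
  by (simp add: qpochhammer_def)

lemma one_minus_power_nonzero:
  fixes q :: complex
  assumes "norm q < 1" "n > 0"
  shows "1 - q ^ n \<noteq> 0"
proof
  assume "1 - q ^ n = 0"
  then have "norm q ^ n = 1" by (simp flip: norm_power)
  then show False using assms by (metis power_less_one_iff norm_ge_zero less_irrefl)
qed

lemma convergent_prod_qpochhammer:
  fixes a q :: complex
  assumes "norm q < 1"
  shows "convergent_prod (\<lambda>j. 1 - a * q ^ j)"
proof (intro abs_convergent_prod_imp_convergent_prod summable_imp_abs_convergent_prod)
  show "summable (\<lambda>j. norm (1 - a * q ^ j - 1))"
    using assms by (auto simp: norm_mult norm_power intro!: summable_mult summable_geometric)
qed

lemma qpochhammer_LIMSEQ:
  assumes "norm q < 1"
  shows "qpochhammer a q \<longlonglongrightarrow> qpochhammer_inf a q"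
  using convergent_prod_LIMSEQ[OF convergent_prod_qpochhammer[OF assms, of a]]
  unfolding qpochhammer_inf_def qpochhammer_def[abs_def]
  by (simp add: LIMSEQ_lessThan_iff_atMost)

lemma qpochhammer_inf_nonzero:
  assumes "norm q < 1" "\<And>j. a * q ^ j \<noteq> 1"
  shows "qpochhammer_inf a q \<noteq> 0"
  unfolding qpochhammer_inf_def
  by (rule prodinf_nonzero[OF convergent_prod_qpochhammer]) (use assms in auto)

lemma qpochhammer_self_nonzero:
  assumes "norm q < 1"
  shows "qpochhammer q q n \<noteq> 0"
  using one_minus_power_nonzero[OF assms, of "Suc _"] by (auto simp: qpochhammer_def)

lemma qpochhammer_inf_self_nonzero:
  assumes "norm q < 1"
  shows "qpochhammer_inf q q \<noteq> 0"
  using one_minus_power_nonzero[OF assms, of "Suc _"]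
  by (intro qpochhammer_inf_nonzero assms) (metis eq_iff_diff_eq_0 power_Suc zero_less_Suc)

text \<open>
  Giving the reciprocal the value 0 at negative indices makes the recurrence
  \<open>qrec_minus_1\<close> hold for all integers, so the closed forms below need no boundary cases.
\<close>

definition qrec :: "complex \<Rightarrow> int \<Rightarrow> complex" where
  "qrec q m = (if m < 0 then 0 else 1 / qpochhammer q q (nat m))"

lemma qrec_minus_1:
  assumes "norm q < 1"
  shows "qrec q (m - 1) = (1 - q powi m) * qrec q m"
proof (cases "m > 0")
  case True
  then obtain k where m: "m = int (Suc k)" by (metis pos_int_cases Suc_pred)
  have "qrec q (m - 1) = 1 / qpochhammer q q k" by (simp add: qrec_def m)
  moreover have "qrec q m = 1 / (qpochhammer q q k * (1 - q ^ Suc k))"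
    unfolding m qrec_def nat_int by (simp add: qpochhammer_Suc del: of_nat_Suc)
  moreover have "q powi m = q ^ Suc k" unfolding m power_int_of_nat ..
  ultimately show ?thesis
    using one_minus_power_nonzero[OF assms, of "Suc k"] by simp
\<comment> \<open>For m = 0 the factor 1 - q^0 vanishes; for m < 0 both values of
  \<open>qrec\<close> are 0.\<close>
qed (auto simp: qrec_def)

lemma qrec_LIMSEQ:
  assumes "norm q < 1" and f: "filterlim f at_top sequentially"
  shows "(\<lambda>N. qrec q (f N)) \<longlonglongrightarrow> 1 / qpochhammer_inf q q"
proof -
  have "filterlim (\<lambda>N. nat (f N)) sequentially sequentially"
    using filterlim_compose[OF filterlim_nat_sequentially f] .
  from filterlim_compose[OF qpochhammer_LIMSEQ[OF assms(1)] this]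
  have "(\<lambda>N. 1 / qpochhammer q q (nat (f N))) \<longlonglongrightarrow> 1 / qpochhammer_inf q q"
    by (intro tendsto_intros) (auto simp: qpochhammer_inf_self_nonzero assms)
  moreover have "\<forall>\<^sub>F N in sequentially. 1 / qpochhammer q q (nat (f N)) = qrec q (f N)"
    using f[unfolded filterlim_at_top, rule_format, of 0]
    by (rule eventually_mono) (simp add: qrec_def)
  ultimately show ?thesis by (rule Lim_transform_eventually)
qed

section \<open>Unconditional sums over the integers\<close>

lemma abs_le_square_int: "\<bar>j\<bar> \<le> j\<^sup>2" for j :: int
proof -
  have "\<bar>j\<bar> * 1 \<le> \<bar>j\<bar> * \<bar>j\<bar>"
    by (cases "j = 0") (auto intro!: mult_left_mono simp del: mult_1_right abs_mult_self_eq)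
  then show ?thesis by (simp add: power2_eq_square)
qed

lemma summable_on_int_geometric:
  fixes r :: real
  assumes "0 \<le> r" "r < 1"
  shows "(\<lambda>j::int. r ^ nat \<bar>j\<bar>) summable_on UNIV"
proof -
  have nat: "(\<lambda>n::nat. r ^ n) summable_on UNIV"
    using assms by (intro norm_summable_imp_summable_on) (auto simp: summable_geometric)
  have "(\<lambda>j::int. r ^ nat \<bar>j\<bar>) summable_on range int"
    by (subst summable_on_reindex) (auto simp: o_def nat)
  moreover have "(\<lambda>j::int. r ^ nat \<bar>j\<bar>) summable_on range (\<lambda>n. - int n)"
    by (subst summable_on_reindex) (auto simp: o_def nat inj_on_def)
  moreover have "range int \<union> range (\<lambda>n. - int n) = UNIV"
    by (auto simp: image_iff) (metis int_cases2)
  ultimately show ?thesis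
    by (metis summable_on_union)
qed

text \<open>Domination by the two-sided geometric series; it serves the exponents j (3 j + 1) / 2
  and j^2.\<close>

lemma norm_powi_summable_on:
  fixes q :: complex
  assumes "norm q < 1" "\<And>j. e j \<ge> \<bar>j\<bar>"
  shows "(\<lambda>j::int. norm (q powi e j)) summable_on UNIV"
proof (rule summable_on_comparison_test[OF summable_on_int_geometric[of "norm q"]])
  fix j :: int
  have "e j = int (nat (e j))" "nat \<bar>j\<bar> \<le> nat (e j)" using assms(2)[of j] by auto
  then show "norm (q powi e j) \<le> norm q ^ nat \<bar>j\<bar>"
    using assms(1) by (metis norm_power power_int_of_nat power_decreasing norm_ge_zero less_imp_le)
qed (use assms in auto)

lemma norm_signed_mult: "norm ((-1) powi j * z) = norm z" for z :: complex
  by (simp add: norm_mult norm_power_int)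

text \<open>Symmetric partial sums therefore compute unconditional sums, which links
  \<open>infsum\<close> to the finite identity of Shanks.\<close>

lemma int_intervals_finite_subsets_at_top:
  "filterlim (\<lambda>n. {- int n..int n}) (finite_subsets_at_top UNIV) sequentially"
  unfolding filterlim_finite_subsets_at_top
proof safe
  fix X :: "int set" assume "finite X"
  then obtain b where b: "\<And>x. x \<in> X \<Longrightarrow> \<bar>x\<bar> \<le> b"
    using that[of "Max (insert 0 (abs ` X))"] by simp
  show "\<forall>\<^sub>F n in sequentially. finite {- int n..int n} \<and> X \<subseteq> {- int n..int n} \<and> {- int n..int n} \<subseteq> UNIV"
    using eventually_ge_at_top[of "nat b"]
  proof eventually_elim
    case (elim n)
    then show ?case using b by (fastforce simp: abs_le_iff)
  qed
qed

subsection \<open>Euler's pentagonal number theorem, after Shanks\<close>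

text \<open>Multiplied by (q;q)_n, the summand is the difference of the s-th terms of Shanks' sums
  for n + 1 and n. Here \<open>triangle s\<close> is s (s + 1) / 2.\<close>

lemma shanks_telescope:
  assumes "norm q < 1"
  shows "(\<Sum>s\<le>m. (-1) ^ s / qpochhammer q q s *
           ((1 - q ^ Suc n) * q ^ (s * Suc n + triangle s) - q ^ (s * n + triangle s)))
         = - ((-1) ^ m / qpochhammer q q m * q ^ (Suc m * Suc n + triangle m))"
proof (induction m)
  case (Suc m)
  define E where "E = q ^ (Suc m * n + triangle m)"
  define z where "z = q * q ^ m"
  \<comment> \<open>The induction step with its powers abstracted: z is q^(m+1), P and P' are
    (q;q)_m and (q;q)_(m+1), c is (-1)^m and w is q^(n+1).\<close>
  have *: "- (c / P * (E * z)) + (-1) * c / P' * ((1 - w) * (E * z\<^sup>2) - E * z) =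
      - ((-1) * c / P' * (E * z\<^sup>2 * w))"
    if "1 - z \<noteq> 0" "P' = P * (1 - z)" "P \<noteq> 0" for c P P' w
    unfolding that(2) using that(1,3) by (simp add: divide_simps) algebra
  have exps: "q ^ (Suc m * Suc n + triangle m) = E * z"
    "q ^ (Suc m * Suc n + triangle (Suc m)) = E * z\<^sup>2"
    "q ^ (Suc m * n + triangle (Suc m)) = E * z"
    "q ^ (Suc (Suc m) * Suc n + triangle (Suc m)) = E * z\<^sup>2 * q ^ Suc n"
  proof -
    have "Suc m * Suc n + triangle m = (Suc m * n + triangle m) + Suc m"
      "Suc m * Suc n + triangle (Suc m) = (Suc m * n + triangle m) + Suc m * 2"
      "Suc m * n + triangle (Suc m) = (Suc m * n + triangle m) + Suc m"
      "Suc (Suc m) * Suc n + triangle (Suc m) = (Suc m * n + triangle m) + Suc m * 2 + Suc n"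
      by simp_all
    moreover have "z = q ^ Suc m" by (simp add: z_def)
    ultimately show "q ^ (Suc m * Suc n + triangle m) = E * z"
      "q ^ (Suc m * Suc n + triangle (Suc m)) = E * z\<^sup>2"
      "q ^ (Suc m * n + triangle (Suc m)) = E * z"
      "q ^ (Suc (Suc m) * Suc n + triangle (Suc m)) = E * z\<^sup>2 * q ^ Suc n"
      unfolding E_def by (simp_all only: power_add power_mult)
  qed
  have "1 - z \<noteq> 0" using one_minus_power_nonzero[OF assms, of "Suc m"] by (simp add: z_def)
  moreover have "qpochhammer q q (Suc m) = qpochhammer q q m * (1 - z)"
    by (simp add: qpochhammer_Suc z_def)
  moreover have "qpochhammer q q m \<noteq> 0" using qpochhammer_self_nonzero[OF assms] .
  ultimately show ?case
    unfolding sum.atMost_Suc Suc exps power_Suc[of "-1::complex"] by (rule *)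
qed simp

text \<open>The exponents at j = n and j = -(n + 1), in the form in which Shanks' sums produce
  them.\<close>

lemma pentagonal_exponents:
  "int n * (3 * int n + 1) div 2 = int (n * n + triangle n)"
  "- int (Suc n) * (3 * - int (Suc n) + 1) div 2 = int (Suc n * Suc n + triangle n)"
proof -
  have t: "2 * int (triangle k) = int k * (int k + 1)" for k
    by (induction k) (auto simp: algebra_simps)
  have "int n * (3 * int n + 1) = int (n * n + triangle n) * 2"
    using t[of n] by (simp add: algebra_simps)
  then show "int n * (3 * int n + 1) div 2 = int (n * n + triangle n)" by simp
  have "- int (Suc n) * (3 * - int (Suc n) + 1) = int (Suc n * Suc n + triangle n) * 2"
    using t[of n] by (simp add: algebra_simps)
  then show "- int (Suc n) * (3 * - int (Suc n) + 1) div 2 = int (Suc n * Suc n + triangle n)"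
    by (metis nonzero_mult_div_cancel_right zero_neq_numeral)
qed

text \<open>From n to n + 1, the new summand s = n + 1 supplies the term j = n + 1, and the
  telescoped change of the other summands supplies j = -(n + 1).\<close>

lemma shanks_identity:
  assumes "norm q < 1"
  shows "(\<Sum>s\<le>n. (-1) ^ s * (qpochhammer q q n / qpochhammer q q s) * q ^ (s * n + triangle s))
       = (\<Sum>j\<in>{- int n..int n}. (-1) powi j * q powi (j * (3 * j + 1) div 2))"
    (is "?F n = ?S n")
proof (induction n)
  case (Suc n)
  let ?P = "qpochhammer q q"
  let ?t = "\<lambda>s. (-1) ^ s / ?P s *
           ((1 - q ^ Suc n) * q ^ (s * Suc n + triangle s) - q ^ (s * n + triangle s))"
  have "?F (Suc n) = (\<Sum>s\<le>n. (-1) ^ s * (?P (Suc n) / ?P s) * q ^ (s * Suc n + triangle s))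
          + (-1) ^ Suc n * q ^ (Suc n * Suc n + triangle (Suc n))"
    unfolding sum.atMost_Suc using qpochhammer_self_nonzero[OF assms, of "Suc n"]
    by (simp only: divide_self_if mult_1_right if_False)
  also have "(\<Sum>s\<le>n. (-1) ^ s * (?P (Suc n) / ?P s) * q ^ (s * Suc n + triangle s))
     = ?F n + ?P n * (\<Sum>s\<le>n. ?t s)"
    unfolding sum_distrib_left sum.distrib[symmetric]
    by (intro sum.cong refl) (simp add: qpochhammer_Suc algebra_simps diff_divide_distrib)
  also have "?P n * (\<Sum>s\<le>n. ?t s) = (-1) ^ Suc n * q ^ (Suc n * Suc n + triangle n)"
    unfolding shanks_telescope[OF assms] using qpochhammer_self_nonzero[OF assms, of n] by simp
  finally have F: "?F (Suc n) = ?S n + (-1) ^ Suc n * q ^ (Suc n * Suc n + triangle n)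
     + (-1) ^ Suc n * q ^ (Suc n * Suc n + triangle (Suc n))"
    using Suc by simp
  have set: "{- int (Suc n)..int (Suc n)} = insert (- int (Suc n)) (insert (int (Suc n)) {- int n..int n})"
    by auto
  have "?S (Suc n) = (-1) powi (- int (Suc n)) * q powi (int (Suc n * Suc n + triangle n))
     + ((-1) powi int (Suc n) * q powi (int (Suc n * Suc n + triangle (Suc n))) + ?S n)"
    unfolding set by (subst sum.insert, simp, simp, subst sum.insert, simp, simp)
       (simp only: pentagonal_exponents)
  also have "(-1::complex) powi (- int (Suc n)) = (-1) ^ Suc n"
    by (simp only: power_int_minus power_int_of_nat) (simp flip: power_inverse)
  finally show ?case unfolding F power_int_of_nat by simp
qed simp

text \<open>For s \<ge> 1 the exponent is at least n and the quotients of products are bounded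
  uniformly, so the n terms add up to O(n |q|^n).\<close>

lemma shanks_remainder_tendsto_0:
  assumes "norm q < 1"
  shows "(\<lambda>n. (\<Sum>s=1..n. (-1) ^ s * (qpochhammer q q n / qpochhammer q q s)
            * q ^ (s * n + triangle s))) \<longlonglongrightarrow> 0"
proof -
  let ?P = "qpochhammer q q"
  have "Bseq ?P" using qpochhammer_LIMSEQ[OF assms] by (metis convergent_imp_Bseq convergentI)
  then obtain K where K: "K > 0" "\<And>n. norm (?P n) \<le> K" by (auto elim: BseqE)
  \<comment> \<open>The reciprocals are bounded because the limit of the products is
    nonzero.\<close>
  have "(\<lambda>n. inverse (?P n)) \<longlonglongrightarrow> inverse (qpochhammer_inf q q)"
    by (intro tendsto_inverse qpochhammer_LIMSEQ qpochhammer_inf_self_nonzero assms)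
  then have "Bseq (\<lambda>n. inverse (?P n))" by (metis convergent_imp_Bseq convergentI)
  then obtain L where L: "L > 0" "\<And>n. norm (inverse (?P n)) \<le> L" by (auto elim: BseqE)
  show ?thesis
  proof (rule Lim_null_comparison)
    show "\<forall>\<^sub>F n in sequentially. norm (\<Sum>s=1..n. (-1) ^ s * (?P n / ?P s) * q ^ (s * n + triangle s))
        \<le> K * L * (of_nat n * norm q ^ n)"
    proof (rule always_eventually, rule allI)
      fix n
      have "norm (\<Sum>s=1..n. (-1) ^ s * (?P n / ?P s) * q ^ (s * n + triangle s))
         \<le> of_nat (card {1..n}) * (K * L * norm q ^ n)"
      proof (rule sum_norm_bound)
        fix s assume "s \<in> {1..n}"
        then have "n \<le> s * n + triangle s" by (cases s) auto
        then have "norm q ^ (s * n + triangle s) \<le> norm q ^ n"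
          using assms by (intro power_decreasing) auto
        moreover have "norm (?P n) * norm (inverse (?P s)) \<le> K * L"
          using K L by (intro mult_mono) auto
        ultimately show "norm ((-1) ^ s * (?P n / ?P s) * q ^ (s * n + triangle s)) \<le> K * L * norm q ^ n"
          unfolding norm_mult norm_power divide_inverse norm_minus_cancel norm_one power_one mult_1_left
          using K L by (intro mult_mono) auto
      qed
      then show "norm (\<Sum>s=1..n. (-1) ^ s * (?P n / ?P s) * q ^ (s * n + triangle s))
        \<le> K * L * (of_nat n * norm q ^ n)" by (simp add: mult_ac)
    qed
    show "(\<lambda>n. K * L * (of_nat n * norm q ^ n)) \<longlonglongrightarrow> 0"
      using assms by (intro tendsto_mult_right_zero powser_times_n_limit_0) auto
  qed
qed

text \<open>In the limit of Shanks' identity only the summand s = 0 survives, and it equals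
  (q;q)_n.\<close>

theorem pentagonal_number_theorem:
  assumes "norm q < 1"
  shows "(\<Sum>\<^sub>\<infinity>j::int. (-1) powi j * q powi (j * (3 * j + 1) div 2)) = qpochhammer_inf q q"
proof -
  let ?f = "\<lambda>j::int. (-1) powi j * q powi (j * (3 * j + 1) div 2)"
  let ?P = "qpochhammer q q"
  have ge: "j * (3 * j + 1) div 2 \<ge> \<bar>j\<bar>" for j :: int
  proof -
    \<comment> \<open>From |j| \<le> j^2 follows 3 j^2 + j \<ge> 3 |j| - |j|.\<close>
    have "2 * \<bar>j\<bar> \<le> j * (3 * j + 1)"
      using abs_le_square_int[of j]
      unfolding power2_eq_square distrib_left mult.left_commute[of j 3] by linarith
    then show ?thesis by linarith
  qed
  have "(\<lambda>j. norm (?f j)) summable_on UNIV"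
    unfolding norm_signed_mult by (rule norm_powi_summable_on[OF assms ge])
  then have "(?f has_sum infsum ?f UNIV) UNIV"
    by (rule has_sum_infsum[OF abs_summable_summable])
  then have lim: "(\<lambda>n. \<Sum>j\<in>{- int n..int n}. ?f j) \<longlonglongrightarrow> infsum ?f UNIV"
    unfolding has_sum_def by (rule filterlim_compose[OF _ int_intervals_finite_subsets_at_top])
  have "(\<lambda>n. ?P n + (\<Sum>s=1..n. (-1) ^ s * (?P n / ?P s) * q ^ (s * n + triangle s)))
     \<longlonglongrightarrow> qpochhammer_inf q q + 0"
    by (intro tendsto_add qpochhammer_LIMSEQ shanks_remainder_tendsto_0 assms)
  moreover have "?P n + (\<Sum>s=1..n. (-1) ^ s * (?P n / ?P s) * q ^ (s * n + triangle s))
     = (\<Sum>j\<in>{- int n..int n}. ?f j)" for n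
    unfolding shanks_identity[OF assms, symmetric] atMost_atLeast0
    by (subst sum.atLeast_Suc_atMost[of 0]) simp_all
  ultimately have "(\<lambda>n. \<Sum>j\<in>{- int n..int n}. ?f j) \<longlonglongrightarrow> qpochhammer_inf q q"
    by (simp only: add_0_right)
  with lim show ?thesis by (rule LIMSEQ_unique)
qed

subsection \<open>Laurent coefficients of symmetric products\<close>

text \<open>The case distinction keeps \<open>nat\<close> from sending a negative k + \<alpha> to 0,
  which would give the binomial 1 in place of 0.\<close>

definition central_binom :: "nat \<Rightarrow> int \<Rightarrow> complex" where
  "central_binom k \<alpha> = (if int k + \<alpha> < 0 then 0 else of_nat ((2 * k) choose nat (int k + \<alpha>)))"

lemma central_binom_0: "central_binom 0 \<alpha> = (if \<alpha> = 0 then 1 else 0)"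
  by (auto simp: central_binom_def)

lemma central_binom_eq_0:
  assumes "k < nat \<bar>\<alpha>\<bar>"
  shows "central_binom k \<alpha> = 0"
  using assms by (auto simp: central_binom_def intro!: binomial_eq_0)

text \<open>Pascal's rule applied twice, that is, multiplication by z + 2 + 1/z.\<close>

lemma central_binom_Suc:
  "central_binom (Suc k) \<alpha> = central_binom k (\<alpha> - 1) + 2 * central_binom k \<alpha> + central_binom k (\<alpha> + 1)"
proof -
  consider "int k + \<alpha> < 0" | "int k + \<alpha> = 0" | "int k + \<alpha> > 0" by linarith
  then show ?thesis
  proof cases
    case 3
    define m where "m = nat (int k + \<alpha>) - 1"
    from 3 have "nat (int (Suc k) + \<alpha>) = Suc (Suc m)" "nat (int k + (\<alpha> - 1)) = m"
      "nat (int k + \<alpha>) = Suc m" "nat (int k + (\<alpha> + 1)) = Suc (Suc m)" by (auto simp: m_def)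
    then show ?thesis using 3 by (simp add: central_binom_def)
  next
    case 2
    then have "nat (int (Suc k) + \<alpha>) = Suc 0" "nat (int k + (\<alpha> + 1)) = Suc 0" by auto
    then show ?thesis using 2 by (simp add: central_binom_def)
  next
    case 1
    \<comment> \<open>At k + \<alpha> = -1 the left side and the last summand are both 1; below that
      everything vanishes.\<close>
    then show ?thesis by (cases "int k + \<alpha> = -1") (auto simp: central_binom_def)
  qed
qed

text \<open>The bound is uniform in \<alpha>, and 4^k spreads as a factor 4 over each of the k
  weights of a set.\<close>

lemma norm_central_binom_le: "norm (central_binom k \<alpha>) \<le> 4 ^ k"
proof -
  have "real ((2 * k) choose m) \<le> real (2 ^ (2 * k))" for m
    unfolding of_nat_le_iff by (rule binomial_le_pow2)
  then have "real ((2 * k) choose m) \<le> 4 ^ k" for m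
    by (simp add: power_mult)
  then show ?thesis by (simp add: central_binom_def)
qed

text \<open>
  The coefficient of \<open>z\<^sup>\<alpha>\<close> in \<open>\<Prod>t\<in>S. 1 + (z + 2 + 1/z) * x t\<close>, since
  \<open>central_binom k \<alpha>\<close> is the coefficient of \<open>z\<^sup>\<alpha>\<close> in \<open>(z + 2 + 1/z)\<^sup>k\<close>.
\<close>

definition laurent_coeff :: "(nat \<Rightarrow> complex) \<Rightarrow> nat set \<Rightarrow> int \<Rightarrow> complex" where
  "laurent_coeff x S \<alpha> = (\<Sum>T\<in>Pow S. central_binom (card T) \<alpha> * (\<Prod>t\<in>T. x t))"

lemma laurent_coeff_empty: "laurent_coeff x {} \<alpha> = (if \<alpha> = 0 then 1 else 0)"
  by (simp add: laurent_coeff_def central_binom_0)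

text \<open>Multiplication by one more factor: the subsets of \<open>insert s S\<close> split
  according to whether they contain s.\<close>

lemma laurent_coeff_insert:
  assumes "finite S" "s \<notin> S"
  shows "laurent_coeff x (insert s S) \<alpha> = laurent_coeff x S \<alpha> +
    x s * (laurent_coeff x S (\<alpha> - 1) + 2 * laurent_coeff x S \<alpha> + laurent_coeff x S (\<alpha> + 1))"
proof -
  let ?f = "\<lambda>\<alpha> T. central_binom (card T) \<alpha> * (\<Prod>t\<in>T. x t)"
  have "laurent_coeff x (insert s S) \<alpha> = laurent_coeff x S \<alpha> + (\<Sum>T\<in>insert s ` Pow S. ?f \<alpha> T)"
    unfolding laurent_coeff_def Pow_insert using assms
    by (subst sum.union_disjoint) auto
  also have "(\<Sum>T\<in>insert s ` Pow S. ?f \<alpha> T) = (\<Sum>T\<in>Pow S. ?f \<alpha> (insert s T))"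
  proof (subst sum.reindex)
    show "inj_on (insert s) (Pow S)" using assms by (auto simp: inj_on_def)
  qed simp
  also have "\<dots> = (\<Sum>T\<in>Pow S. x s * (?f (\<alpha> - 1) T + 2 * ?f \<alpha> T + ?f (\<alpha> + 1) T))"
  proof (rule sum.cong[OF refl])
    fix T assume "T \<in> Pow S"
    then have "finite T" "s \<notin> T" using assms by (auto intro: finite_subset)
    then show "?f \<alpha> (insert s T) = x s * (?f (\<alpha> - 1) T + 2 * ?f \<alpha> T + ?f (\<alpha> + 1) T)"
      by (simp add: central_binom_Suc algebra_simps)
  qed
  finally show ?thesis
    by (simp only: laurent_coeff_def sum.distrib sum_distrib_left distrib_left)
qed

text \<open>
  For \<open>x = y / (1 - y)\<^sup>2\<close> the factor \<open>1 + (z + 2 + 1/z) x\<close> is \<open>(1 + z y) (1 + y/z) / (1 - y)\<^sup>2\<close>.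
\<close>

lemma laurent_coeff_step:
  assumes "y (Suc N) \<noteq> 1"
  shows "laurent_coeff (\<lambda>t. y t / (1 - y t)\<^sup>2) {1..Suc N} \<alpha> * (1 - y (Suc N))\<^sup>2 =
    (1 + (y (Suc N))\<^sup>2) * laurent_coeff (\<lambda>t. y t / (1 - y t)\<^sup>2) {1..N} \<alpha> +
    y (Suc N) * (laurent_coeff (\<lambda>t. y t / (1 - y t)\<^sup>2) {1..N} (\<alpha> - 1) +
                 laurent_coeff (\<lambda>t. y t / (1 - y t)\<^sup>2) {1..N} (\<alpha> + 1))"
proof -
  let ?w = "laurent_coeff (\<lambda>t. y t / (1 - y t)\<^sup>2) {1..N}"
  have set: "{1..Suc N} = insert (Suc N) {1..N}" by auto
  have "(1 - y (Suc N))\<^sup>2 \<noteq> 0" using assms by simp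
  then have "(A + y (Suc N) / (1 - y (Suc N))\<^sup>2 * B) * (1 - y (Suc N))\<^sup>2 =
     A * (1 - y (Suc N))\<^sup>2 + y (Suc N) * B" for A B
    by (simp add: distrib_right)
  \<comment> \<open>The coefficient 1 + y^2 arises as (1 - y)^2 + 2 y.\<close>
  then show ?thesis
    unfolding set by (simp add: laurent_coeff_insert) (simp add: power2_eq_square algebra_simps)
qed

section \<open>Sums over all finite sets of positive integers\<close>

definition finite_pos_sets :: "nat set set" where
  "finite_pos_sets = {T. finite T \<and> 0 \<notin> T}"

text \<open>A finite family of sets lies in some \<open>Pow ?S\<close>, over which the sum factors
  into the product of the g t + 1, at most exp of the sum of g. Partial sums are thus
  bounded.\<close>

lemma finite_pos_sets_summable:
  fixes g :: "nat \<Rightarrow> real"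
  assumes nonneg: "\<And>t. g t \<ge> 0" and "summable (\<lambda>t. g (Suc t))"
  shows "(\<lambda>T. \<Prod>t\<in>T. g t) summable_on finite_pos_sets"
proof (rule nonneg_bdd_above_summable_on)
  show "bdd_above (sum (\<lambda>T. \<Prod>t\<in>T. g t) ` {F. F \<subseteq> finite_pos_sets \<and> finite F})"
  proof (rule bdd_aboveI2)
    fix F assume F: "F \<in> {F. F \<subseteq> finite_pos_sets \<and> finite F}"
    then have "finite (\<Union>F)" by (auto simp: finite_pos_sets_def)
    then obtain N where N: "\<Union>F \<subseteq> {..<N}" by (meson finite_nat_iff_bounded)
    let ?S = "Suc ` {..<N}"
    have "F \<subseteq> Pow ?S"
    proof safe
      fix T t assume "T \<in> F" "t \<in> T"
      then have "T \<in> finite_pos_sets" "t < N" using F N by auto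
      then show "t \<in> ?S" using \<open>t \<in> T\<close> by (cases t) (auto simp: finite_pos_sets_def)
    qed
    then have "(\<Sum>T\<in>F. \<Prod>t\<in>T. g t) \<le> (\<Sum>T\<in>Pow ?S. \<Prod>t\<in>T. g t)"
      by (intro sum_mono2) (auto intro!: prod_nonneg nonneg)
    also have "\<dots> = (\<Prod>t\<in>?S. g t + 1)" by (subst prod_add) auto
    also have "\<dots> \<le> exp (\<Sum>t\<in>?S. g t)"
      using prod_le_exp_sum[of ?S g] nonneg by (simp add: add.commute)
    also have "(\<Sum>t\<in>?S. g t) = (\<Sum>t<N. g (Suc t))" by (subst sum.reindex) auto
    also have "exp \<dots> \<le> exp (\<Sum>t. g (Suc t))"
      using sum_le_suminf[OF assms(2)] nonneg by auto
    finally show "(\<Sum>T\<in>F. \<Prod>t\<in>T. g t) \<le> exp (\<Sum>t. g (Suc t))" .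
  qed
qed (auto intro!: prod_nonneg nonneg)

text \<open>This turns a sum over all finite sets into the limit of the coefficients of the products
  truncated at N.\<close>

lemma Pow_interval_finite_subsets_at_top:
  "filterlim (\<lambda>N. Pow {1..N}) (finite_subsets_at_top finite_pos_sets) sequentially"
  unfolding filterlim_finite_subsets_at_top
proof (intro allI impI)
  fix F assume F: "finite F \<and> F \<subseteq> finite_pos_sets"
  then have "finite (\<Union>F)" by (auto simp: finite_pos_sets_def)
  then obtain N where N: "\<Union>F \<subseteq> {..<N}" by (meson finite_nat_iff_bounded)
  show "\<forall>\<^sub>F n in sequentially. finite (Pow {1..n}) \<and> F \<subseteq> Pow {1..n} \<and> Pow {1..n} \<subseteq> finite_pos_sets"
    using eventually_ge_at_top[of N]
  proof eventually_elim
    case (elim n)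
    have "t \<in> {1..n}" if "T \<in> F" "t \<in> T" for T t
    proof -
      have "T \<in> finite_pos_sets" using that F by auto
      then have "t \<noteq> 0" using \<open>t \<in> T\<close> by (metis (mono_tags) finite_pos_sets_def mem_Collect_eq)
      moreover have "t < N" using that N by auto
      ultimately show ?thesis using elim by simp
    qed
    then show ?case by (auto simp: finite_pos_sets_def intro: finite_subset)
  qed
qed

text \<open>The coefficient of z^\<alpha> in the infinite product over t \<ge> 1 of 1 + (z + 2 +
  1/z) x t, expanded over finite choices of factors.\<close>

definition laurent_coeff_inf :: "(nat \<Rightarrow> complex) \<Rightarrow> int \<Rightarrow> complex" where
  "laurent_coeff_inf x \<alpha> = (\<Sum>\<^sub>\<infinity>T\<in>finite_pos_sets. central_binom (card T) \<alpha> * (\<Prod>t\<in>T. x t))"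

context
  fixes x :: "nat \<Rightarrow> complex"
  assumes x: "summable (\<lambda>t. norm (x (Suc t)))"
begin

lemma norm_prod_summable: "(\<lambda>T. \<Prod>t\<in>T. 4 * norm (x t)) summable_on finite_pos_sets"
  by (rule finite_pos_sets_summable) (use x in \<open>auto intro: summable_mult\<close>)

lemma norm_laurent_term_le:
  "norm (central_binom (card T) \<alpha> * (\<Prod>t\<in>T. x t)) \<le> (\<Prod>t\<in>T. 4 * norm (x t))"
  by (simp add: norm_mult prod_norm[symmetric] prod.distrib mult_right_mono prod_nonneg norm_central_binom_le)

lemma laurent_terms_abs_summable:
  "(\<lambda>T. norm (central_binom (card T) \<alpha> * (\<Prod>t\<in>T. x t))) summable_on finite_pos_sets"
  by (rule summable_on_comparison_test[OF norm_prod_summable norm_laurent_term_le]) auto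

lemmas laurent_terms_summable = abs_summable_summable[OF laurent_terms_abs_summable]

lemma laurent_coeff_LIMSEQ:
  "(\<lambda>N. laurent_coeff x {1..N} \<alpha>) \<longlonglongrightarrow> laurent_coeff_inf x \<alpha>"
  unfolding laurent_coeff_def laurent_coeff_inf_def
  using has_sum_infsum[OF laurent_terms_summable, unfolded has_sum_def]
  by (rule filterlim_compose[OF _ Pow_interval_finite_subsets_at_top])

text \<open>The bound is independent of \<alpha>, as needed for summation along a line where
  \<alpha> varies with \<beta>.\<close>

lemma norm_laurent_coeff_inf_le:
  "norm (laurent_coeff_inf x \<alpha>) \<le> (\<Sum>\<^sub>\<infinity>T\<in>finite_pos_sets. \<Prod>t\<in>T. 4 * norm (x t))"
  unfolding laurent_coeff_inf_def
  by (rule norm_infsum_le[OF has_sum_infsum[OF laurent_terms_summable]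
        has_sum_infsum[OF norm_prod_summable] norm_laurent_term_le])

text \<open>Sets are grouped by cardinality, which absolute summability permits; cardinalities below
  |\<alpha>| contribute nothing because the binomial vanishes.\<close>

lemma laurent_coeff_inf_by_card:
  "(\<Sum>\<^sub>\<infinity>k\<in>{nat \<bar>\<alpha>\<bar>..}. of_nat ((2 * k) choose nat (int k + \<alpha>)) *
      (\<Sum>\<^sub>\<infinity>T\<in>increasing_tuples k. \<Prod>t\<in>T. x t)) = laurent_coeff_inf x \<alpha>"
proof -
  let ?f = "\<lambda>k T. central_binom k \<alpha> * (\<Prod>t\<in>T. x t)"
  let ?g = "\<lambda>T. central_binom (card T) \<alpha> * (\<Prod>t\<in>T. x t)"
  have bij: "bij_betw snd (Sigma UNIV increasing_tuples) finite_pos_sets"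
    by (rule bij_betwI[where g = "\<lambda>T. (card T, T)"])
       (auto simp: increasing_tuples_def finite_pos_sets_def intro!: gr0I)
  have "(\<lambda>p. ?g (snd p)) summable_on Sigma UNIV increasing_tuples"
    unfolding summable_on_reindex_bij_betw[OF bij, of ?g] by (rule laurent_terms_summable)
  also have "?this \<longleftrightarrow> (\<lambda>(k, T). ?f k T) summable_on Sigma UNIV increasing_tuples"
    by (rule summable_on_cong) (auto simp: increasing_tuples_def)
  finally have summable: "(\<lambda>(k, T). ?f k T) summable_on Sigma UNIV increasing_tuples" .
  have "laurent_coeff_inf x \<alpha> = infsum (\<lambda>p. ?g (snd p)) (Sigma UNIV increasing_tuples)"
    unfolding laurent_coeff_inf_def infsum_reindex_bij_betw[OF bij, of ?g] ..
  also have "\<dots> = infsum (\<lambda>(k, T). ?f k T) (Sigma UNIV increasing_tuples)"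
    by (rule infsum_cong) (auto simp: increasing_tuples_def)
  also have "\<dots> = (\<Sum>\<^sub>\<infinity>k. \<Sum>\<^sub>\<infinity>T\<in>increasing_tuples k. ?f k T)"
    by (rule infsum_Sigma'_banach[OF summable, symmetric])
  also have "\<dots> = (\<Sum>\<^sub>\<infinity>k. central_binom k \<alpha> * (\<Sum>\<^sub>\<infinity>T\<in>increasing_tuples k. \<Prod>t\<in>T. x t))"
    by (simp add: infsum_cmult_right')
  also have "\<dots> = (\<Sum>\<^sub>\<infinity>k\<in>{nat \<bar>\<alpha>\<bar>..}. of_nat ((2 * k) choose nat (int k + \<alpha>)) *
      (\<Sum>\<^sub>\<infinity>T\<in>increasing_tuples k. \<Prod>t\<in>T. x t))"
  proof (rule infsum_cong_neutral)
    fix k assume "k \<in> UNIV \<inter> {nat \<bar>\<alpha>\<bar>..}"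
    then have "\<not> int k + \<alpha> < 0" by auto
    then show "central_binom k \<alpha> * (\<Sum>\<^sub>\<infinity>T\<in>increasing_tuples k. \<Prod>t\<in>T. x t) =
      of_nat ((2 * k) choose nat (int k + \<alpha>)) * (\<Sum>\<^sub>\<infinity>T\<in>increasing_tuples k. \<Prod>t\<in>T. x t)"
      by (simp add: central_binom_def)
  qed (auto intro!: central_binom_eq_0 simp: not_le)
  finally show ?thesis ..
qed

end

text \<open>For t \<ge> 1 the bound r^t is at most r, so the denominators stay above (1 - r)^2 and a
  geometric series dominates.\<close>

lemma summable_div_one_minus_square:
  fixes y :: "nat \<Rightarrow> complex"
  assumes "r < 1" and y: "\<And>t. norm (y (Suc t)) \<le> r ^ Suc t"
  shows "summable (\<lambda>t. norm (y (Suc t) / (1 - y (Suc t))\<^sup>2))"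
proof (rule summable_comparison_test')
  have r: "0 \<le> r" using order_trans[OF norm_ge_zero y[of 0]] by simp
  show "summable (\<lambda>t. (r / (1 - r)\<^sup>2) * r ^ t)"
    using assms r by (intro summable_mult summable_geometric) auto
  fix t
  have "r ^ Suc t \<le> r ^ 1" using assms r by (intro power_decreasing) auto
  then have "1 - r \<le> norm (1 - y (Suc t))"
    using norm_triangle_ineq2[of 1 "y (Suc t)"] y[of t] by simp
  then have "(1 - r)\<^sup>2 \<le> (norm (1 - y (Suc t)))\<^sup>2"
    using assms by (intro power_mono) auto
  then have "norm (y (Suc t)) / (norm (1 - y (Suc t)))\<^sup>2 \<le> r ^ Suc t / (1 - r)\<^sup>2"
    using assms y[of t] r by (intro frac_le) auto
  then show "norm (norm (y (Suc t) / (1 - y (Suc t))\<^sup>2)) \<le> r / (1 - r)\<^sup>2 * r ^ t"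
    by (simp add: norm_divide norm_power)
qed

subsection \<open>The coefficients attached to MacMahon's series\<close>

definition A_base :: "complex \<Rightarrow> nat \<Rightarrow> complex" where
  "A_base q t = q ^ t"

text \<open>The index 0, where the subtraction truncates, lies in no tuple.\<close>

definition C_base :: "complex \<Rightarrow> nat \<Rightarrow> complex" where
  "C_base q t = q ^ (2 * t - 1)"

definition macmahon_weight :: "(nat \<Rightarrow> complex) \<Rightarrow> nat \<Rightarrow> complex" where
  "macmahon_weight y t = y t / (1 - y t)\<^sup>2"

lemma MacMahon_A_eq:
  "MacMahon_A k q = (\<Sum>\<^sub>\<infinity>T\<in>increasing_tuples k. \<Prod>t\<in>T. macmahon_weight (A_base q) t)"
  by (simp add: MacMahon_A_def macmahon_weight_def A_base_def prod_dividef power_sum)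

lemma MacMahon_C_eq:
  "MacMahon_C k q = (\<Sum>\<^sub>\<infinity>T\<in>increasing_tuples k. \<Prod>t\<in>T. macmahon_weight (C_base q) t)"
  unfolding MacMahon_C_def
proof (rule infsum_cong)
  fix T assume T: "T \<in> increasing_tuples k"
  \<comment> \<open>As \<open>T\<close> has k positive elements, subtracting k takes 1 from each
    exponent.\<close>
  have "(\<Sum>t\<in>T. 2 * t) = (\<Sum>t\<in>T. 2 * t - 1 + 1)"
    using T by (intro sum.cong) (auto simp: increasing_tuples_def)
  also have "\<dots> = (\<Sum>t\<in>T. 2 * t - 1) + k"
    using T unfolding sum.distrib by (simp add: increasing_tuples_def)
  finally have "(\<Sum>t\<in>T. 2 * t) - k = (\<Sum>t\<in>T. 2 * t - 1)" by simp
  then show "q ^ ((\<Sum>t\<in>T. 2 * t) - k) / (\<Prod>t\<in>T. (1 - q ^ (2 * t - 1))\<^sup>2)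
      = (\<Prod>t\<in>T. macmahon_weight (C_base q) t)"
    by (simp add: macmahon_weight_def C_base_def prod_dividef power_sum)
qed

lemma filterlim_int_plus_at_top:
  "filterlim (\<lambda>N. int N + b) at_top sequentially"
  unfolding filterlim_at_top
proof
  fix Z
  show "\<forall>\<^sub>F N in sequentially. Z \<le> int N + b"
    using eventually_ge_at_top[of "nat (Z - b)"]
  proof eventually_elim
    case (elim N)
    then show ?case by linarith
  qed
qed

context
  fixes q :: complex
  assumes q0: "0 < norm q" and q1: "norm q < 1"
begin

lemma q_nz: "q \<noteq> 0"
  using q0 by auto

lemma q2_less: "norm (q\<^sup>2) < 1"
  using q1 by (simp add: norm_power power_less_one_iff)

lemma summable_A: "summable (\<lambda>t. norm (macmahon_weight (A_base q) (Suc t)))"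
  unfolding macmahon_weight_def
  by (rule summable_div_one_minus_square[OF q1]) (simp add: A_base_def norm_mult norm_power)

lemma summable_C: "summable (\<lambda>t. norm (macmahon_weight (C_base q) (Suc t)))"
  unfolding macmahon_weight_def
proof (rule summable_div_one_minus_square[OF q1])
  fix t show "norm (C_base q (Suc t)) \<le> norm q ^ Suc t"
    unfolding C_base_def norm_power using q1 by (intro power_decreasing) auto
qed

abbreviation coeff_A where "coeff_A \<equiv> laurent_coeff_inf (macmahon_weight (A_base q))"
abbreviation coeff_C where "coeff_C \<equiv> laurent_coeff_inf (macmahon_weight (C_base q))"

section \<open>Finite triple products\<close>

text \<open>With y = q^(N+1) and u = q^\<alpha>, the three products compare the closed forms for N
  at \<alpha>, \<alpha> - 1 and \<alpha> + 1 with that for N + 1 at \<alpha>; on the right stand the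
  two factors by which (q;q)_(2N+1) grows.\<close>

lemma step_identity_A:
  fixes u y :: complex
  assumes "u \<noteq> 0"
  shows "(1 + y\<^sup>2) * ((1 - y * u) * (1 - y * q / u)) +
     y * (q / u * ((1 - y * u / q) * (1 - y * u)) + u * ((1 - y / u) * (1 - y * q / u)))
     = (1 - y\<^sup>2) * (1 - q * y\<^sup>2)"
  using assms q_nz by (simp add: divide_simps) algebra

text \<open>The analogue in base q^2, with y = q^(2N+1) and u = q^(2\<beta>); on the right stand the
  two factors by which (q^2;q^2)_(2N) grows.\<close>

lemma step_identity_C:
  fixes u y :: complex
  assumes "u \<noteq> 0"
  shows "(1 + y\<^sup>2) * ((1 - y * q * u) * (1 - y * q / u)) +
     y * (q / u * ((1 - y * u / q) * (1 - y * q * u)) + q * u * ((1 - y / (q * u)) * (1 - y * q / u)))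
     = (1 - y\<^sup>2) * (1 - (y * q)\<^sup>2)"
  using assms q_nz by (simp add: divide_simps) algebra

text \<open>The sum over \<open>\<alpha>\<close> and \<open>\<alpha> - 1\<close> is the effect of an extra factor \<open>1 + z\<close>, which completes the triple product.\<close>

lemma finite_A:
  "(laurent_coeff (macmahon_weight (A_base q)) {1..N} \<alpha> +
    laurent_coeff (macmahon_weight (A_base q)) {1..N} (\<alpha> - 1)) * (qpochhammer q q N)\<^sup>2
   = q powi (\<alpha> * (\<alpha> - 1) div 2) * qpochhammer q q (2 * N + 1) *
     (qrec q (int N + \<alpha>) * qrec q (int N + 1 - \<alpha>))"
proof (induction N arbitrary: \<alpha>)
  case 0
  show ?case
  \<comment> \<open>Only for these two values are both arguments of \<open>qrec\<close>
    nonnegative.\<close>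
  proof (cases "\<alpha> = 0 \<or> \<alpha> = 1")
    case True
    then show ?thesis
      using one_minus_power_nonzero[OF q1, of 1]
      by (auto simp: laurent_coeff_empty qrec_def qpochhammer_Suc)
  next
    case False
    then have "\<alpha> < 0 \<or> 1 - \<alpha> < 0" by auto
    then show ?thesis using False by (auto simp: laurent_coeff_empty qrec_def)
  qed
next
  case (Suc N)
  let ?w = "laurent_coeff (macmahon_weight (A_base q))"
  \<comment> \<open>The closed forms of \<open>b N\<close> are rewritten through \<open>R\<close>
    and \<open>S\<close>, the reciprocals at N + 1. The common factor e P R S then comes out and
    \<open>step_identity_A\<close> remains.\<close>
  define b where "b N \<alpha> = (?w {1..N} \<alpha> + ?w {1..N} (\<alpha> - 1)) * (qpochhammer q q N)\<^sup>2" for N \<alpha>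
  define y where "y = q ^ Suc N"
  define u where "u = q powi \<alpha>"
  define e where "e = q powi (\<alpha> * (\<alpha> - 1) div 2)"
  define R where "R = qrec q (int (Suc N) + \<alpha>)"
  define S where "S = qrec q (int (Suc N) + 1 - \<alpha>)"
  define P where "P = qpochhammer q q (2 * N + 1)"
  have u: "u \<noteq> 0" by (simp add: u_def q_nz)
  have y: "q powi int (Suc N) = y" unfolding y_def by (rule power_int_of_nat)
  have IH: "b N \<alpha> = q powi (\<alpha> * (\<alpha> - 1) div 2) * P * (qrec q (int N + \<alpha>) * qrec q (int N + 1 - \<alpha>))" for \<alpha>
    unfolding b_def Suc.IH P_def ..
  have "int N + \<alpha> = int (Suc N) + \<alpha> - 1" by simp
  then have R1: "qrec q (int N + \<alpha>) = (1 - y * u) * R"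
    by (simp only: qrec_minus_1[OF q1] R_def power_int_add[OF disjI1[OF q_nz]] y u_def)
  have "int N + (\<alpha> - 1) = int (Suc N) + (\<alpha> - 1) - 1" "int N + \<alpha> = int (Suc N) + (\<alpha> - 1)" by simp_all
  then have R2: "qrec q (int N + (\<alpha> - 1)) = (1 - y * u / q) * ((1 - y * u) * R)"
    unfolding R1[symmetric]
    by (simp only: qrec_minus_1[OF q1] power_int_add[OF disjI1[OF q_nz]]
          power_int_diff[OF disjI1[OF q_nz]] power_int_1_right y u_def times_divide_eq_right)
  have "int N + 1 - \<alpha> = int (Suc N) + (1 - \<alpha>) - 1" "int (Suc N) + 1 - \<alpha> = int (Suc N) + (1 - \<alpha>)" by simp_all
  then have S1: "qrec q (int N + 1 - \<alpha>) = (1 - y * q / u) * S"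
    by (simp only: qrec_minus_1[OF q1] S_def power_int_add[OF disjI1[OF q_nz]]
          power_int_diff[OF disjI1[OF q_nz]] power_int_1_right y u_def times_divide_eq_right)
  have "int N + 1 - (\<alpha> + 1) = int (Suc N) - \<alpha> - 1" "int N + 1 - \<alpha> = int (Suc N) - \<alpha>" by simp_all
  then have S2: "qrec q (int N + 1 - (\<alpha> + 1)) = (1 - y / u) * ((1 - y * q / u) * S)"
    unfolding S1[symmetric]
    by (simp only: qrec_minus_1[OF q1] power_int_diff[OF disjI1[OF q_nz]] y u_def)
  \<comment> \<open>The numerator changes by a multiple of 2, so the halved exponent changes by
    exactly 1 - \<alpha>.\<close>
  have "(\<alpha> - 1) * (\<alpha> - 1 - 1) = \<alpha> * (\<alpha> - 1) + (1 - \<alpha>) * 2" by (simp add: algebra_simps)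
  then have "(\<alpha> - 1) * (\<alpha> - 1 - 1) div 2 = \<alpha> * (\<alpha> - 1) div 2 + (1 - \<alpha>)" by simp
  then have e1: "q powi ((\<alpha> - 1) * (\<alpha> - 1 - 1) div 2) = e * (q / u)"
    by (simp add: e_def u_def power_int_add power_int_diff q_nz)
  have "(\<alpha> + 1) * (\<alpha> + 1 - 1) = \<alpha> * (\<alpha> - 1) + \<alpha> * 2" by (simp add: algebra_simps)
  then have "(\<alpha> + 1) * (\<alpha> + 1 - 1) div 2 = \<alpha> * (\<alpha> - 1) div 2 + \<alpha>" by simp
  then have e2: "q powi ((\<alpha> + 1) * (\<alpha> + 1 - 1) div 2) = e * u"
    by (simp add: e_def u_def power_int_add q_nz)
  have b0: "b N \<alpha> = e * P * R * S * ((1 - y * u) * (1 - y * q / u))"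
    unfolding IH R1 S1 e_def by (simp only: mult_ac)
  have S0: "qrec q (int N + 1 - (\<alpha> - 1)) = S" unfolding S_def by (rule arg_cong[where f = "qrec q"]) simp
  have b1: "b N (\<alpha> - 1) = e * P * R * S * (q / u * ((1 - y * u / q) * (1 - y * u)))"
    unfolding IH R2 e1 S0 by (simp only: mult_ac)
  have R0: "qrec q (int N + (\<alpha> + 1)) = R" unfolding R_def by (rule arg_cong[where f = "qrec q"]) simp
  have b2: "b N (\<alpha> + 1) = e * P * R * S * (u * ((1 - y / u) * (1 - y * q / u)))"
    unfolding IH S2 e2 R0 by (simp only: mult_ac)
  have step: "?w {1..Suc N} \<alpha> * (1 - y)\<^sup>2 = (1 + y\<^sup>2) * ?w {1..N} \<alpha> +
      y * (?w {1..N} (\<alpha> - 1) + ?w {1..N} (\<alpha> + 1))" for \<alpha>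
    unfolding macmahon_weight_def using laurent_coeff_step[of "A_base q" N \<alpha>]
      one_minus_power_nonzero[OF q1, of "Suc N"] by (simp add: A_base_def y_def)
  have "qpochhammer q q (Suc N) = qpochhammer q q N * (1 - y)"
    by (simp add: qpochhammer_Suc y_def)
  then have "b (Suc N) \<alpha> = (?w {1..Suc N} \<alpha> * (1 - y)\<^sup>2 + ?w {1..Suc N} (\<alpha> - 1) * (1 - y)\<^sup>2) * (qpochhammer q q N)\<^sup>2"
    unfolding b_def by (simp only: power_mult_distrib distrib_left distrib_right mult_ac)
  \<comment> \<open>The recurrence is linear with coefficients independent of \<alpha>, so sums of
    two consecutive coefficients satisfy it too.\<close>
  also have "\<dots> = (1 + y\<^sup>2) * b N \<alpha> + y * (b N (\<alpha> - 1) + b N (\<alpha> + 1))"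
    unfolding step b_def by (simp add: algebra_simps)
  also have "\<dots> = e * P * R * S * ((1 + y\<^sup>2) * ((1 - y * u) * (1 - y * q / u)) +
     y * (q / u * ((1 - y * u / q) * (1 - y * u)) + u * ((1 - y / u) * (1 - y * q / u))))"
    unfolding b0 b1 b2 distrib_left by (simp only: mult_ac)
  also have "\<dots> = e * (P * ((1 - y\<^sup>2) * (1 - q * y\<^sup>2))) * (R * S)"
    unfolding step_identity_A[OF u] by (simp only: mult_ac)
  also have "P * ((1 - y\<^sup>2) * (1 - q * y\<^sup>2)) = qpochhammer q q (2 * Suc N + 1)"
  proof -
    have "2 * Suc N + 1 = Suc (Suc (2 * N + 1))" by simp
    moreover have "q * q ^ (2 * N + 1) = y\<^sup>2" "q * q ^ Suc (2 * N + 1) = q * y\<^sup>2"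
      by (simp_all add: y_def power_mult power2_eq_square power_mult_distrib flip: power_even_eq)
    ultimately show ?thesis by (simp only: qpochhammer_Suc P_def mult.assoc)
  qed
  finally show ?case unfolding b_def e_def R_def S_def .
qed

text \<open>Finite Jacobi triple product in base q^2: once (q;q^2)_N^2 clears the denominators, the
  coefficient is q^(\<beta>^2) times the Gaussian binomial of 2N over N + \<beta>.\<close>

lemma finite_C:
  "laurent_coeff (macmahon_weight (C_base q)) {1..N} \<beta> * (qpochhammer q (q\<^sup>2) N)\<^sup>2
   = q powi (\<beta>\<^sup>2) * qpochhammer (q\<^sup>2) (q\<^sup>2) (2 * N) *
     (qrec (q\<^sup>2) (int N + \<beta>) * qrec (q\<^sup>2) (int N - \<beta>))"
proof (induction N arbitrary: \<beta>)
  case 0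
  show ?case by (auto simp: laurent_coeff_empty qrec_def)
next
  case (Suc N)
  let ?w = "laurent_coeff (macmahon_weight (C_base q))"
  define p where "p = q\<^sup>2"
  have p: "p \<noteq> 0" "norm p < 1" using q_nz q2_less by (simp_all add: p_def)
  define b where "b N \<beta> = ?w {1..N} \<beta> * (qpochhammer q p N)\<^sup>2" for N \<beta>
  define y where "y = q ^ (2 * N + 1)"
  define u where "u = p powi \<beta>"
  define e where "e = q powi (\<beta>\<^sup>2)"
  define R where "R = qrec p (int (Suc N) + \<beta>)"
  define S where "S = qrec p (int (Suc N) - \<beta>)"
  define P where "P = qpochhammer p p (2 * N)"
  have u: "u \<noteq> 0" by (simp add: u_def p)
  \<comment> \<open>Here y is the new odd power q^(2N+1), hence p^(N+1) = q^(2N+2) = y q.\<close>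
  have y: "p powi int (Suc N) = y * q"
    unfolding y_def p_def power_int_of_nat by (simp add: power2_eq_square power_mult_distrib mult_2 power_add)
  have IH: "b N \<beta> = q powi (\<beta>\<^sup>2) * P * (qrec p (int N + \<beta>) * qrec p (int N - \<beta>))" for \<beta>
    unfolding b_def Suc.IH P_def p_def ..
  have "int N + \<beta> = int (Suc N) + \<beta> - 1" by simp
  then have R1: "qrec p (int N + \<beta>) = (1 - y * q * u) * R"
    by (simp only: qrec_minus_1[OF p(2)] R_def power_int_add[OF disjI1[OF p(1)]] y u_def)
  have "int N + (\<beta> - 1) = int (Suc N) + \<beta> - 1 - 1" "int N + \<beta> = int (Suc N) + \<beta> - 1" by simp_all
  then have "qrec p (int N + (\<beta> - 1)) = (1 - y * q * u / p) * qrec p (int N + \<beta>)"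
    by (simp only: qrec_minus_1[OF p(2), of "int (Suc N) + \<beta> - 1"] power_int_add[OF disjI1[OF p(1)]]
          power_int_diff[OF disjI1[OF p(1)]] power_int_1_right y u_def)
  then have R2: "qrec p (int N + (\<beta> - 1)) = (1 - y * u / q) * ((1 - y * q * u) * R)"
    unfolding R1 by (simp add: p_def power2_eq_square q_nz)
  have "int N - \<beta> = int (Suc N) - \<beta> - 1" by simp
  then have S1: "qrec p (int N - \<beta>) = (1 - y * q / u) * S"
    by (simp only: qrec_minus_1[OF p(2)] S_def power_int_diff[OF disjI1[OF p(1)]] y u_def)
  have "int N - (\<beta> + 1) = int (Suc N) - \<beta> - 1 - 1" "int N - \<beta> = int (Suc N) - \<beta> - 1" by simp_all
  then have "qrec p (int N - (\<beta> + 1)) = (1 - y * q / u / p) * qrec p (int N - \<beta>)"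
    by (simp only: qrec_minus_1[OF p(2), of "int (Suc N) - \<beta> - 1"]
          power_int_diff[OF disjI1[OF p(1)]] power_int_1_right y u_def)
  then have S2: "qrec p (int N - (\<beta> + 1)) = (1 - y / (q * u)) * ((1 - y * q / u) * S)"
    unfolding S1 by (simp add: p_def power2_eq_square q_nz mult.commute)
  \<comment> \<open>Moving \<beta> by one changes \<beta>^2 by 1 + 2\<beta> or 1 - 2\<beta>, hence
    \<open>e\<close> by the factor q u or q / u.\<close>
  have pu: "q powi (2 * \<beta>) = u" unfolding u_def p_def by (simp add: power_int_mult)
  have "(\<beta> - 1)\<^sup>2 = \<beta>\<^sup>2 + (1 - 2 * \<beta>)" by (simp add: power2_eq_square algebra_simps)
  then have e1: "q powi ((\<beta> - 1)\<^sup>2) = e * (q / u)"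
    by (simp only: e_def pu power_int_add[OF disjI1[OF q_nz]] power_int_diff[OF disjI1[OF q_nz]] power_int_1_right)
  have "(\<beta> + 1)\<^sup>2 = \<beta>\<^sup>2 + (1 + 2 * \<beta>)" by (simp add: power2_eq_square algebra_simps)
  then have e2: "q powi ((\<beta> + 1)\<^sup>2) = e * (q * u)"
    by (simp only: e_def pu power_int_add[OF disjI1[OF q_nz]] power_int_1_right)
  have b0: "b N \<beta> = e * P * R * S * ((1 - y * q * u) * (1 - y * q / u))"
    unfolding IH R1 S1 e_def by (simp only: mult_ac)
  have S0: "qrec p (int N - (\<beta> - 1)) = S" unfolding S_def by (rule arg_cong[where f = "qrec p"]) simp
  have b1: "b N (\<beta> - 1) = e * P * R * S * (q / u * ((1 - y * u / q) * (1 - y * q * u)))"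
    unfolding IH R2 e1 S0 by (simp only: mult_ac)
  have R0: "qrec p (int N + (\<beta> + 1)) = R" unfolding R_def by (rule arg_cong[where f = "qrec p"]) simp
  have b2: "b N (\<beta> + 1) = e * P * R * S * (q * u * ((1 - y / (q * u)) * (1 - y * q / u)))"
    unfolding IH S2 e2 R0 by (simp only: mult_ac)
  have step: "?w {1..Suc N} \<beta> * (1 - y)\<^sup>2 = (1 + y\<^sup>2) * ?w {1..N} \<beta> +
      y * (?w {1..N} (\<beta> - 1) + ?w {1..N} (\<beta> + 1))"
    unfolding macmahon_weight_def using laurent_coeff_step[of "C_base q" N \<beta>]
      one_minus_power_nonzero[OF q1, of "2 * N + 1"] by (simp add: C_base_def y_def)
  have "qpochhammer q p (Suc N) = qpochhammer q p N * (1 - y)"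
    by (simp add: qpochhammer_Suc y_def p_def power_mult)
  then have "b (Suc N) \<beta> = ?w {1..Suc N} \<beta> * (1 - y)\<^sup>2 * (qpochhammer q p N)\<^sup>2"
    unfolding b_def by (simp only: power_mult_distrib mult_ac)
  also have "\<dots> = (1 + y\<^sup>2) * b N \<beta> + y * (b N (\<beta> - 1) + b N (\<beta> + 1))"
    unfolding step b_def by (simp add: algebra_simps)
  also have "\<dots> = e * P * R * S * ((1 + y\<^sup>2) * ((1 - y * q * u) * (1 - y * q / u)) +
     y * (q / u * ((1 - y * u / q) * (1 - y * q * u)) + q * u * ((1 - y / (q * u)) * (1 - y * q / u))))"
    unfolding b0 b1 b2 distrib_left by (simp only: mult_ac)
  also have "\<dots> = e * (P * ((1 - y\<^sup>2) * (1 - (y * q)\<^sup>2))) * (R * S)"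
    unfolding step_identity_C[OF u] by (simp only: mult_ac)
  also have "P * ((1 - y\<^sup>2) * (1 - (y * q)\<^sup>2)) = qpochhammer p p (2 * Suc N)"
  proof -
    have "2 * Suc N = Suc (Suc (2 * N))" by simp
    moreover have "p * p ^ (2 * N) = y\<^sup>2" "p * p ^ Suc (2 * N) = (y * q)\<^sup>2"
      by (simp_all add: y_def p_def flip: power_mult power_Suc power_add power_Suc2)
    ultimately show ?thesis by (simp only: qpochhammer_Suc P_def mult.assoc)
  qed
  finally show ?case unfolding b_def e_def R_def S_def p_def .
qed

section \<open>Coefficients of the infinite products\<close>

text \<open>In the limit of \<open>finite_A\<close> the Gaussian binomial gives one factor 1/(q;q),
  and the cleared denominators give the other two.\<close>

lemma coeff_A_sum:
  "coeff_A \<alpha> + coeff_A (\<alpha> - 1) = q powi (\<alpha> * (\<alpha> - 1) div 2) / qpochhammer_inf q q ^ 3"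
proof -
  let ?Q = "qpochhammer_inf q q"
  have "strict_mono (\<lambda>N::nat. 2 * N + 1)" by (auto simp: strict_mono_def)
  from LIMSEQ_subseq_LIMSEQ[OF qpochhammer_LIMSEQ[OF q1, of q] this]
  have P: "(\<lambda>N. qpochhammer q q (2 * N + 1)) \<longlonglongrightarrow> ?Q" by (simp add: o_def)
  have R: "(\<lambda>N. qrec q (int N + \<alpha>)) \<longlonglongrightarrow> 1 / ?Q"
    using filterlim_int_plus_at_top[of \<alpha>] by (intro qrec_LIMSEQ q1) simp
  have S: "(\<lambda>N. qrec q (int N + 1 - \<alpha>)) \<longlonglongrightarrow> 1 / ?Q"
    using filterlim_int_plus_at_top[of "1 - \<alpha>"] by (intro qrec_LIMSEQ q1) (simp add: add_diff_eq)
  have "(\<lambda>N. q powi (\<alpha> * (\<alpha> - 1) div 2) * qpochhammer q q (2 * N + 1) *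
     (qrec q (int N + \<alpha>) * qrec q (int N + 1 - \<alpha>)))
     \<longlonglongrightarrow> q powi (\<alpha> * (\<alpha> - 1) div 2) * ?Q * (1 / ?Q * (1 / ?Q))"
    by (intro tendsto_mult tendsto_const P R S)
  moreover have "(\<lambda>N. q powi (\<alpha> * (\<alpha> - 1) div 2) * qpochhammer q q (2 * N + 1) *
     (qrec q (int N + \<alpha>) * qrec q (int N + 1 - \<alpha>)))
     \<longlonglongrightarrow> (coeff_A \<alpha> + coeff_A (\<alpha> - 1)) * ?Q\<^sup>2"
    unfolding finite_A[symmetric]
    by (intro tendsto_mult tendsto_add tendsto_power laurent_coeff_LIMSEQ summable_A qpochhammer_LIMSEQ q1)
  ultimately have "(coeff_A \<alpha> + coeff_A (\<alpha> - 1)) * ?Q\<^sup>2 = q powi (\<alpha> * (\<alpha> - 1) div 2) * ?Q * (1 / ?Q * (1 / ?Q))"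
    by (rule LIMSEQ_unique[rotated])
  then have "(coeff_A \<alpha> + coeff_A (\<alpha> - 1)) * ?Q\<^sup>2 = q powi (\<alpha> * (\<alpha> - 1) div 2) / ?Q"
    using qpochhammer_inf_self_nonzero[OF q1] by simp
  then show ?thesis
    using qpochhammer_inf_self_nonzero[OF q1]
    by (simp add: eq_divide_eq power2_eq_square power3_eq_cube mult.assoc)
qed

lemma qpochhammer_inf_odd_nonzero: "qpochhammer_inf q (q\<^sup>2) \<noteq> 0"
proof (rule qpochhammer_inf_nonzero[OF q2_less])
  fix j show "q * (q\<^sup>2) ^ j \<noteq> 1"
    using one_minus_power_nonzero[OF q1, of "2 * j + 1"] by (simp add: power_mult)
qed

text \<open>In the limit of \<open>finite_C\<close> the Gaussian binomial tends to 1/(q^2;q^2), and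
  the cleared denominators give (q;q^2)^2.\<close>

lemma coeff_C_eq:
  "coeff_C \<beta> = q powi (\<beta>\<^sup>2) / (qpochhammer_inf q (q\<^sup>2) ^ 2 * qpochhammer_inf (q\<^sup>2) (q\<^sup>2))"
proof -
  let ?P = "qpochhammer_inf (q\<^sup>2) (q\<^sup>2)"
  let ?O = "qpochhammer_inf q (q\<^sup>2)"
  have "strict_mono (\<lambda>N::nat. 2 * N)" by (auto simp: strict_mono_def)
  from LIMSEQ_subseq_LIMSEQ[OF qpochhammer_LIMSEQ[OF q2_less, of "q\<^sup>2"] this]
  have P: "(\<lambda>N. qpochhammer (q\<^sup>2) (q\<^sup>2) (2 * N)) \<longlonglongrightarrow> ?P" by (simp add: o_def)
  have R: "(\<lambda>N. qrec (q\<^sup>2) (int N + \<beta>)) \<longlonglongrightarrow> 1 / ?P"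
    using filterlim_int_plus_at_top[of \<beta>] by (intro qrec_LIMSEQ q2_less) simp
  have S: "(\<lambda>N. qrec (q\<^sup>2) (int N - \<beta>)) \<longlonglongrightarrow> 1 / ?P"
    using filterlim_int_plus_at_top[of "- \<beta>"] by (intro qrec_LIMSEQ q2_less) simp
  have "(\<lambda>N. q powi (\<beta>\<^sup>2) * qpochhammer (q\<^sup>2) (q\<^sup>2) (2 * N) *
     (qrec (q\<^sup>2) (int N + \<beta>) * qrec (q\<^sup>2) (int N - \<beta>)))
     \<longlonglongrightarrow> q powi (\<beta>\<^sup>2) * ?P * (1 / ?P * (1 / ?P))"
    by (intro tendsto_mult tendsto_const P R S)
  moreover have "(\<lambda>N. q powi (\<beta>\<^sup>2) * qpochhammer (q\<^sup>2) (q\<^sup>2) (2 * N) *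
     (qrec (q\<^sup>2) (int N + \<beta>) * qrec (q\<^sup>2) (int N - \<beta>)))
     \<longlonglongrightarrow> coeff_C \<beta> * ?O\<^sup>2"
    unfolding finite_C[symmetric]
    by (intro tendsto_mult tendsto_power laurent_coeff_LIMSEQ summable_C qpochhammer_LIMSEQ q2_less)
  ultimately have "coeff_C \<beta> * ?O\<^sup>2 = q powi (\<beta>\<^sup>2) * ?P * (1 / ?P * (1 / ?P))"
    by (rule LIMSEQ_unique[rotated])
  then have "coeff_C \<beta> * ?O\<^sup>2 = q powi (\<beta>\<^sup>2) / ?P"
    using qpochhammer_inf_self_nonzero[OF q2_less] by simp
  then show ?thesis
    using qpochhammer_inf_self_nonzero[OF q2_less] qpochhammer_inf_odd_nonzero
    by (simp add: eq_divide_eq mult.assoc)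
qed

section \<open>Summation along the lines \<alpha> + 2 \<beta> = m\<close>

text \<open>\<open>coeff_A\<close> is bounded and \<open>coeff_C\<close> decays like q^(\<beta>^2).
  This permits adding the two line sums term by term.\<close>

lemma signed_product_summable:
  "(\<lambda>\<beta>::int. (-1) powi \<beta> * coeff_A (m - 2 * \<beta>) * coeff_C \<beta>) summable_on UNIV"
proof (rule abs_summable_summable)
  define M where "M = (\<Sum>\<^sub>\<infinity>T\<in>finite_pos_sets. \<Prod>t\<in>T. 4 * norm (macmahon_weight (A_base q) t))"
  define K where "K = norm (qpochhammer_inf q (q\<^sup>2) ^ 2 * qpochhammer_inf (q\<^sup>2) (q\<^sup>2))"
  have "(\<lambda>\<beta>::int. M / K * norm (q powi (\<beta>\<^sup>2))) summable_on UNIV"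
    by (intro summable_on_cmult_right norm_powi_summable_on q1 abs_le_square_int)
  then show "(\<lambda>\<beta>. norm ((-1) powi \<beta> * coeff_A (m - 2 * \<beta>) * coeff_C \<beta>)) summable_on UNIV"
  proof (rule summable_on_comparison_test)
    fix \<beta> :: int
    have "norm ((-1) powi \<beta> * coeff_A (m - 2 * \<beta>) * coeff_C \<beta>)
      = norm (coeff_A (m - 2 * \<beta>)) * (norm (q powi (\<beta>\<^sup>2)) / K)"
      unfolding mult.assoc norm_signed_mult coeff_C_eq K_def by (simp add: norm_mult norm_divide)
    also have "\<dots> \<le> M * (norm (q powi (\<beta>\<^sup>2)) / K)"
      unfolding M_def by (intro mult_right_mono norm_laurent_coeff_inf_le summable_A) (simp add: K_def)
    finally show "norm ((-1) powi \<beta> * coeff_A (m - 2 * \<beta>) * coeff_C \<beta>) \<le> M / K * norm (q powi (\<beta>\<^sup>2))"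
      by simp
  qed simp
qed

text \<open>The line is parametrised by \<beta>, and grouping by cardinality identifies the inner
  sums as Laurent coefficients.\<close>

lemma infsum_line:
  "(\<Sum>\<^sub>\<infinity>(\<alpha>, \<beta>)\<in>{(\<alpha>, \<beta>). \<alpha> + 2 * \<beta> = m}.
        (-1) powi \<beta> *
        (\<Sum>\<^sub>\<infinity>k\<^sub>1\<in>{nat \<bar>\<alpha>\<bar>..}. of_nat ((2 * k\<^sub>1) choose nat (int k\<^sub>1 + \<alpha>)) * MacMahon_A k\<^sub>1 q) *
        (\<Sum>\<^sub>\<infinity>k\<^sub>2\<in>{nat \<bar>\<beta>\<bar>..}. of_nat ((2 * k\<^sub>2) choose nat (int k\<^sub>2 + \<beta>)) * MacMahon_C k\<^sub>2 q))
   = (\<Sum>\<^sub>\<infinity>\<beta>. (-1) powi \<beta> * coeff_A (m - 2 * \<beta>) * coeff_C \<beta>)"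
  unfolding MacMahon_A_eq MacMahon_C_eq laurent_coeff_inf_by_card[OF summable_A]
    laurent_coeff_inf_by_card[OF summable_C]
  by (rule infsum_reindex_bij_witness[where i = "\<lambda>\<beta>. (m - 2 * \<beta>, \<beta>)" and j = snd]) auto

text \<open>The substitution \<beta> = n - \<gamma> cancels the mixed term in n \<gamma>. What is
  left of \<gamma> is twice a pentagonal exponent, so the series is Euler's in q^2.\<close>

lemma line_exponent:
  fixes n \<gamma> :: int
  shows "(3 * n + 1 - 2 * (n - \<gamma>)) * (3 * n + 1 - 2 * (n - \<gamma>) - 1) div 2 + (n - \<gamma>)\<^sup>2
    = (3 * n\<^sup>2 + n) div 2 + 2 * (\<gamma> * (3 * \<gamma> + 1) div 2)"
proof -
  \<comment> \<open>Evenness makes the divisions by 2 exact.\<close>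
  have even: "even (3 * n\<^sup>2 + n)" "even (\<gamma> * (3 * \<gamma> + 1))" by auto
  have "(3 * n + 1 - 2 * (n - \<gamma>)) * (3 * n + 1 - 2 * (n - \<gamma>) - 1) + 2 * (n - \<gamma>)\<^sup>2
    = 3 * n\<^sup>2 + n + 2 * (\<gamma> * (3 * \<gamma> + 1))"
    by (simp add: power2_eq_square algebra_simps)
  then show ?thesis using even by (auto elim!: evenE)
qed

text \<open>At equal \<beta> the two lines have neighbouring \<alpha>, so each pair of terms falls
  under \<open>coeff_A_sum\<close>.\<close>

lemma combined_line_sum:
  "(\<Sum>\<^sub>\<infinity>\<beta>. (-1) powi \<beta> * coeff_A (3 * n + 1 - 2 * \<beta>) * coeff_C \<beta>) +
   (\<Sum>\<^sub>\<infinity>\<beta>. (-1) powi \<beta> * coeff_A (3 * n - 2 * \<beta>) * coeff_C \<beta>)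
   = (-1) powi n * q powi ((3 * n\<^sup>2 + n) div 2) / Theta6 q"
proof -
  define P where "P = qpochhammer_inf (q\<^sup>2) (q\<^sup>2)"
  \<comment> \<open>The factor \<open>P\<close> comes from the denominator of \<open>coeff_C\<close>
    and cancels against the pentagonal series in q^2.\<close>
  define c where "c = (-1) powi n * q powi ((3 * n\<^sup>2 + n) div 2) / (Theta6 q * P)"
  have term_eq: "(-1) powi \<beta> * coeff_A (3 * n + 1 - 2 * \<beta>) * coeff_C \<beta> +
      (-1) powi \<beta> * coeff_A (3 * n - 2 * \<beta>) * coeff_C \<beta>
     = c * ((-1) powi (n - \<beta>) * (q\<^sup>2) powi ((n - \<beta>) * (3 * (n - \<beta>) + 1) div 2))" for \<beta>
  proof -
    define \<gamma> where "\<gamma> = n - \<beta>"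
    have \<beta>: "\<beta> = n - \<gamma>" by (simp add: \<gamma>_def)
    have sgn: "(-1::complex) powi (n - \<gamma>) = (-1) powi n * (-1) powi \<gamma>"
      by (simp add: power_int_diff power_int_minus_one_minus divide_inverse flip: power_int_minus)
    have "3 * n - 2 * \<beta> = 3 * n + 1 - 2 * \<beta> - 1" by simp
    then have "(-1) powi \<beta> * coeff_A (3 * n + 1 - 2 * \<beta>) * coeff_C \<beta> +
      (-1) powi \<beta> * coeff_A (3 * n - 2 * \<beta>) * coeff_C \<beta>
      = (-1) powi \<beta> * (coeff_A (3 * n + 1 - 2 * \<beta>) + coeff_A (3 * n + 1 - 2 * \<beta> - 1)) * coeff_C \<beta>"
      by (simp only: distrib_left distrib_right)
    also have "\<dots> = (-1) powi \<beta> * (q powi ((3 * n + 1 - 2 * \<beta>) * (3 * n + 1 - 2 * \<beta> - 1) div 2)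
        * q powi (\<beta>\<^sup>2)) / (Theta6 q * P)"
      unfolding coeff_A_sum coeff_C_eq Theta6_def P_def by (simp add: mult_ac)
    also have "q powi ((3 * n + 1 - 2 * \<beta>) * (3 * n + 1 - 2 * \<beta> - 1) div 2) * q powi (\<beta>\<^sup>2)
       = q powi ((3 * n\<^sup>2 + n) div 2) * (q\<^sup>2) powi (\<gamma> * (3 * \<gamma> + 1) div 2)"
      unfolding \<beta> power_int_add[OF disjI1[OF q_nz], symmetric] line_exponent
      by (simp only: power_int_add[OF disjI1[OF q_nz]] power_int_mult power_int_numeral)
    finally show ?thesis
      unfolding \<gamma>_def[symmetric] c_def by (simp add: \<beta> sgn)
  qed
  have "(\<Sum>\<^sub>\<infinity>\<beta>. (-1) powi \<beta> * coeff_A (3 * n + 1 - 2 * \<beta>) * coeff_C \<beta>) +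
     (\<Sum>\<^sub>\<infinity>\<beta>. (-1) powi \<beta> * coeff_A (3 * n - 2 * \<beta>) * coeff_C \<beta>)
    = (\<Sum>\<^sub>\<infinity>\<beta>. c * ((-1) powi (n - \<beta>) * (q\<^sup>2) powi ((n - \<beta>) * (3 * (n - \<beta>) + 1) div 2)))"
    unfolding term_eq[symmetric] by (intro infsum_add[symmetric] signed_product_summable)
  also have "\<dots> = (\<Sum>\<^sub>\<infinity>\<gamma>::int. c * ((-1) powi \<gamma> * (q\<^sup>2) powi (\<gamma> * (3 * \<gamma> + 1) div 2)))"
    by (rule infsum_reindex_bij_witness[where i = "\<lambda>\<gamma>. n - \<gamma>" and j = "\<lambda>\<beta>. n - \<beta>"]) auto
  also have "\<dots> = c * P"
    unfolding P_def infsum_cmult_right' pentagonal_number_theorem[OF q2_less] ..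
  also have "\<dots> = (-1) powi n * q powi ((3 * n\<^sup>2 + n) div 2) / Theta6 q"
    using qpochhammer_inf_self_nonzero[OF q2_less] by (simp add: c_def P_def)
  finally show ?thesis .
qed

end

theorem theorem1p1:
  fixes q :: complex and n :: int
  assumes "0 < norm q" and "norm q < 1"
  shows "1 / Theta6 q =
    (-1) powi n * q powi (- ((3 * n\<^sup>2 + n) div 2)) *
    ((\<Sum>\<^sub>\<infinity>(\<alpha>, \<beta>) \<in> {(\<alpha>, \<beta>). \<alpha> + 2 * \<beta> = 3 * n + 1}.
        (-1) powi \<beta> *
        (\<Sum>\<^sub>\<infinity>k\<^sub>1\<in>{nat \<bar>\<alpha>\<bar>..}. of_nat ((2 * k\<^sub>1) choose nat (int k\<^sub>1 + \<alpha>)) * MacMahon_A k\<^sub>1 q) *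
        (\<Sum>\<^sub>\<infinity>k\<^sub>2\<in>{nat \<bar>\<beta>\<bar>..}. of_nat ((2 * k\<^sub>2) choose nat (int k\<^sub>2 + \<beta>)) * MacMahon_C k\<^sub>2 q))
   + (\<Sum>\<^sub>\<infinity>(\<alpha>, \<beta>) \<in> {(\<alpha>, \<beta>). \<alpha> + 2 * \<beta> = 3 * n}.
        (-1) powi \<beta> *
        (\<Sum>\<^sub>\<infinity>k\<^sub>1\<in>{nat \<bar>\<alpha>\<bar>..}. of_nat ((2 * k\<^sub>1) choose nat (int k\<^sub>1 + \<alpha>)) * MacMahon_A k\<^sub>1 q) *
        (\<Sum>\<^sub>\<infinity>k\<^sub>2\<in>{nat \<bar>\<beta>\<bar>..}. of_nat ((2 * k\<^sub>2) choose nat (int k\<^sub>2 + \<beta>)) * MacMahon_C k\<^sub>2 q)))"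
proof -
  have "q \<noteq> 0" using assms by auto
  \<comment> \<open>The sign is its own inverse, so the prefactor undoes that of
    \<open>combined_line_sum\<close>.\<close>
  moreover have "(-1::complex) powi n * (-1) powi n = 1"
    by (simp flip: power_int_mult_distrib)
  ultimately show ?thesis
    unfolding infsum_line[OF assms] combined_line_sum[OF assms]
    by (simp add: power_int_minus field_simps)
qed

end
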